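(* There is a Boolean query definable by a first-order sentence of the form $\exists\vec x\,\forall\vec y\,\psi$ with $\psi$ quantifier-free which cannot be maintained by a $\mathrm{DynProp}$-program with unary auxiliary functions (with auxiliary relations of any arity).
   Context: Dynamic complexity framework with auxiliary functions. A dynamic schema is a pair $(\tau_{\mathrm{in}},\tau_{\mathrm{aux}})$; $\tau_{\mathrm{aux}}$ consists of relation symbols and function symbols of arity at most $1$ (constants being $0$-ary functions); $\tau=\tau_{\mathrm{in}}\cup\tau_{\mathrm{aux}}$. A modification is an insertion $\mathrm{ins}_S(\vec a)$ or deletion $\mathrm{del}_S(\vec a)$ of a tuple $\vec a$ into/from $S\in\tau_{\mathrm{in}}$. The update program contains, for each auxiliary relation symbol $R$ and each $\delta\in\{\mathrm{ins}_S,\mathrm{del}_S\}$, a quantifier-free formula $\varphi^R_\delta(\vec x;\vec y)$ over $\tau$ (terms may use the function symbols), and for each auxiliary function symbol $f$ an update term $t^f_\delta(\vec x;\vec y)$ built from variables, function symbols of $\tau$ and the if-then-else construct $\mathrm{ITE}(\varphi,t_1,t_2)$ with $\varphi$ quantifier-free. Program states are $(D,\mathcal I,\mathcal A)$ over a finite domain $D$. Applying $\delta(\vec a)$ to a state $\mathcal S$ modifies the input by $\delta(\vec a)$, reinterprets each $R$ as $\{\vec b:\mathcal S\models\varphi^R_\delta(\vec a;\vec b)\}$ and each $f$ by $\vec b\mapsto t^f_\delta(\vec a;\vec b)$ evaluated in $\mathcal S$; sequences are applied one after another. A dynamic program $(P,\mathrm{Init},Q)$ has an arbitrary initialization mapping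 $\mathrm{Init}$ and a designated $0$-ary query symbol $Q$; it maintains a Boolean query $\mathcal Q$ if for every input database $\mathcal D$ over any finite domain and every sequence $\alpha$ of modifications, the value of $Q$ in the state reached from $(D,\mathcal D,\mathrm{Init}(\mathcal D))$ by $\alpha$ equals $\mathcal Q(\alpha(\mathcal D))$. *)

theory Defs
  imports Main
begin

datatype ('f, 'v) trm = Var 'v | Fn 'f "('f, 'v) trm list"

datatype ('f, 'r, 'v) fo =
    Bot
  | Eq "('f, 'v) trm" "('f, 'v) trm"
  | Rel 'r "('f, 'v) trm list"
  | Neg "('f, 'r, 'v) fo"
  | Conj "('f, 'r, 'v) fo" "('f, 'r, 'v) fo"
  | Disj "('f, 'r, 'v) fo" "('f, 'r, 'v) fo"
  | Ex 'v "('f, 'r, 'v) fo"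
  | All 'v "('f, 'r, 'v) fo"

text \<open>A vocabulary is a partial map from symbols to arities.\<close>

fun wf_trm :: "('f \<rightharpoonup> nat) \<Rightarrow> ('f, 'v) trm \<Rightarrow> bool" where
  "wf_trm far (Var x) \<longleftrightarrow> True"
| "wf_trm far (Fn f ts) \<longleftrightarrow> far f = Some (length ts) \<and> (\<forall>t\<in>set ts. wf_trm far t)"

primrec wf_fo :: "('f \<rightharpoonup> nat) \<Rightarrow> ('r \<rightharpoonup> nat) \<Rightarrow> ('f, 'r, 'v) fo \<Rightarrow> bool" where
  "wf_fo far rar Bot \<longleftrightarrow> True"
| "wf_fo far rar (Eq s t) \<longleftrightarrow> wf_trm far s \<and> wf_trm far t"
| "wf_fo far rar (Rel r ts) \<longleftrightarrow> rar r = Some (length ts) \<and> (\<forall>t\<in>set ts. wf_trm far t)"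
| "wf_fo far rar (Neg p) \<longleftrightarrow> wf_fo far rar p"
| "wf_fo far rar (Conj p q) \<longleftrightarrow> wf_fo far rar p \<and> wf_fo far rar q"
| "wf_fo far rar (Disj p q) \<longleftrightarrow> wf_fo far rar p \<and> wf_fo far rar q"
| "wf_fo far rar (Ex x p) \<longleftrightarrow> wf_fo far rar p"
| "wf_fo far rar (All x p) \<longleftrightarrow> wf_fo far rar p"

fun fv_trm :: "('f, 'v) trm \<Rightarrow> 'v set" where
  "fv_trm (Var x) = {x}"
| "fv_trm (Fn f ts) = (\<Union>t\<in>set ts. fv_trm t)"

primrec fv_fo :: "('f, 'r, 'v) fo \<Rightarrow> 'v set" where
  "fv_fo Bot = {}"
| "fv_fo (Eq s t) = fv_trm s \<union> fv_trm t"
| "fv_fo (Rel r ts) = (\<Union>t\<in>set ts. fv_trm t)"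
| "fv_fo (Neg p) = fv_fo p"
| "fv_fo (Conj p q) = fv_fo p \<union> fv_fo q"
| "fv_fo (Disj p q) = fv_fo p \<union> fv_fo q"
| "fv_fo (Ex x p) = fv_fo p - {x}"
| "fv_fo (All x p) = fv_fo p - {x}"

primrec qfree :: "('f, 'r, 'v) fo \<Rightarrow> bool" where
  "qfree Bot \<longleftrightarrow> True"
| "qfree (Eq s t) \<longleftrightarrow> True"
| "qfree (Rel r ts) \<longleftrightarrow> True"
| "qfree (Neg p) \<longleftrightarrow> qfree p"
| "qfree (Conj p q) \<longleftrightarrow> qfree p \<and> qfree q"
| "qfree (Disj p q) \<longleftrightarrow> qfree p \<and> qfree q"
| "qfree (Ex x p) \<longleftrightarrow> False"
| "qfree (All x p) \<longleftrightarrow> False"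

primrec eval_trm :: "('f \<Rightarrow> 'd list \<Rightarrow> 'd) \<Rightarrow> ('v \<Rightarrow> 'd) \<Rightarrow> ('f, 'v) trm \<Rightarrow> 'd" where
  "eval_trm F \<sigma> (Var x) = \<sigma> x"
| "eval_trm F \<sigma> (Fn f ts) = F f (map (eval_trm F \<sigma>) ts)"

primrec sat :: "'d set \<Rightarrow> ('f \<Rightarrow> 'd list \<Rightarrow> 'd) \<Rightarrow> ('r \<Rightarrow> 'd list set) \<Rightarrow> ('v \<Rightarrow> 'd) \<Rightarrow>
    ('f, 'r, 'v) fo \<Rightarrow> bool" where
  "sat D F R \<sigma> Bot \<longleftrightarrow> False"
| "sat D F R \<sigma> (Eq s t) \<longleftrightarrow> eval_trm F \<sigma> s = eval_trm F \<sigma> t"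
| "sat D F R \<sigma> (Rel r ts) \<longleftrightarrow> map (eval_trm F \<sigma>) ts \<in> R r"
| "sat D F R \<sigma> (Neg p) \<longleftrightarrow> \<not> sat D F R \<sigma> p"
| "sat D F R \<sigma> (Conj p q) \<longleftrightarrow> sat D F R \<sigma> p \<and> sat D F R \<sigma> q"
| "sat D F R \<sigma> (Disj p q) \<longleftrightarrow> sat D F R \<sigma> p \<or> sat D F R \<sigma> q"
| "sat D F R \<sigma> (Ex x p) \<longleftrightarrow> (\<exists>d\<in>D. sat D F R (\<sigma>(x := d)) p)"
| "sat D F R \<sigma> (All x p) \<longleftrightarrow> (\<forall>d\<in>D. sat D F R (\<sigma>(x := d)) p)"

definition exists_forall_form :: "('f, 'r, 'v) fo \<Rightarrow> bool" where
  "exists_forall_form p \<longleftrightarrow>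
     (\<exists>xs ys q. distinct (xs @ ys) \<and> qfree q \<and> p = foldr Ex xs (foldr All ys q))"

text \<open>Symbols are natural numbers. Tuples are lists. A database interprets symbols outside the
  input schema as the empty relation, so that it carries no information beyond the schema.\<close>

type_synonym 'd db = "nat \<Rightarrow> 'd list set"

definition tuples :: "'d set \<Rightarrow> nat \<Rightarrow> 'd list set" where
  "tuples D k = {as. set as \<subseteq> D \<and> length as = k}"

definition is_db :: "(nat \<rightharpoonup> nat) \<Rightarrow> 'd set \<Rightarrow> 'd db \<Rightarrow> bool" where
  "is_db \<tau> D I \<longleftrightarrow>
     (\<forall>S. case \<tau> S of None \<Rightarrow> I S = {} | Some k \<Rightarrow> I S \<subseteq> tuples D k)"

datatype mod_kind = Ins | Del

type_synonym 'd modification = "mod_kind \<times> nat \<times> 'd list"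

definition is_modification :: "(nat \<rightharpoonup> nat) \<Rightarrow> 'd set \<Rightarrow> 'd modification \<Rightarrow> bool" where
  "is_modification \<tau> D = (\<lambda>(\<delta>, S, as). \<exists>k. \<tau> S = Some k \<and> as \<in> tuples D k)"

fun modify :: "'d modification \<Rightarrow> 'd db \<Rightarrow> 'd db" where
  "modify (Ins, S, as) I = I(S := insert as (I S))"
| "modify (Del, S, as) I = I(S := I S - {as})"

type_synonym 'd boolean_query = "'d set \<Rightarrow> 'd db \<Rightarrow> bool"

text \<open>A query sentence contains no function symbols and no free variables, so the function
  interpretation and the variable assignment below are irrelevant.\<close>

definition query_sentence :: "(nat \<rightharpoonup> nat) \<Rightarrow> (nat, nat, nat) fo \<Rightarrow> bool" where
  "query_sentence \<tau> p \<longleftrightarrow> wf_fo Map.empty \<tau> p \<and> fv_fo p = {}"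

definition defined_query :: "(nat, nat, nat) fo \<Rightarrow> 'd boolean_query" where
  "defined_query p D I \<longleftrightarrow> sat D undefined I undefined p"

text \<open>Relation symbols of the full vocabulary are tagged: \<open>Inl\<close> for input symbols, \<open>Inr\<close> for
  auxiliary ones. In an update formula or term with variables \<open>(x; y)\<close>, the variable
  \<open>Inl i\<close> is the \<open>i\<close>-th component of the modified tuple \<open>x\<close> and \<open>Inr j\<close> the \<open>j\<close>-th
  component of \<open>y\<close>, both counted from 0.\<close>

type_synonym upd_formula = "(nat, nat + nat, nat + nat) fo"

datatype upd_term =
    UVar "nat + nat"
  | UFn nat "upd_term list"
  | ITE upd_formula upd_term upd_term

record schema =
  in_rels :: "nat \<rightharpoonup> nat"
  aux_rels :: "nat \<rightharpoonup> nat"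
  aux_funs :: "nat \<rightharpoonup> nat"

definition wf_schema :: "schema \<Rightarrow> bool" where
  "wf_schema \<tau> \<longleftrightarrow>
     finite (dom (in_rels \<tau>)) \<and> finite (dom (aux_rels \<tau>)) \<and> finite (dom (aux_funs \<tau>))"

definition unary_functions :: "schema \<Rightarrow> bool" where
  "unary_functions \<tau> \<longleftrightarrow> (\<forall>k\<in>ran (aux_funs \<tau>). k \<le> 1)"

text \<open>The numbers \<open>m\<close> and \<open>n\<close> are the lengths of the variable tuples \<open>x\<close> and \<open>y\<close>.\<close>

definition wf_upd_formula :: "schema \<Rightarrow> nat \<Rightarrow> nat \<Rightarrow> upd_formula \<Rightarrow> bool" where
  "wf_upd_formula \<tau> m n p \<longleftrightarrow>
     qfree p \<and> wf_fo (aux_funs \<tau>) (case_sum (in_rels \<tau>) (aux_rels \<tau>)) p \<and>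
     fv_fo p \<subseteq> {..<m} <+> {..<n}"

fun wf_upd_term :: "schema \<Rightarrow> nat \<Rightarrow> nat \<Rightarrow> upd_term \<Rightarrow> bool" where
  "wf_upd_term \<tau> m n (UVar x) \<longleftrightarrow> x \<in> {..<m} <+> {..<n}"
| "wf_upd_term \<tau> m n (UFn f ts) \<longleftrightarrow>
     aux_funs \<tau> f = Some (length ts) \<and> (\<forall>t\<in>set ts. wf_upd_term \<tau> m n t)"
| "wf_upd_term \<tau> m n (ITE p t u) \<longleftrightarrow>
     wf_upd_formula \<tau> m n p \<and> wf_upd_term \<tau> m n t \<and> wf_upd_term \<tau> m n u"

text \<open>\<open>rel_upd P \<delta> S R\<close> and \<open>fun_upd_term P \<delta> S f\<close> give the update of \<open>R\<close> and \<open>f\<close> under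
  modifications of kind \<open>\<delta>\<close> of the input relation \<open>S\<close>.\<close>

record update_program =
  rel_upd :: "mod_kind \<Rightarrow> nat \<Rightarrow> nat \<Rightarrow> upd_formula"
  fun_upd_term :: "mod_kind \<Rightarrow> nat \<Rightarrow> nat \<Rightarrow> upd_term"

definition dynprop_program :: "schema \<Rightarrow> update_program \<Rightarrow> bool" where
  "dynprop_program \<tau> P \<longleftrightarrow>
     (\<forall>\<delta> S m. in_rels \<tau> S = Some m \<longrightarrow>
        (\<forall>R n. aux_rels \<tau> R = Some n \<longrightarrow> wf_upd_formula \<tau> m n (rel_upd P \<delta> S R)) \<and>
        (\<forall>f n. aux_funs \<tau> f = Some n \<longrightarrow> wf_upd_term \<tau> m n (fun_upd_term P \<delta> S f)))"

type_synonym 'd aux = "(nat \<Rightarrow> 'd list set) \<times> (nat \<Rightarrow> 'd list \<Rightarrow> 'd)"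

definition is_aux :: "schema \<Rightarrow> 'd set \<Rightarrow> 'd aux \<Rightarrow> bool" where
  "is_aux \<tau> D = (\<lambda>(A, F).
     (\<forall>R k. aux_rels \<tau> R = Some k \<longrightarrow> A R \<subseteq> tuples D k) \<and>
     (\<forall>f k. aux_funs \<tau> f = Some k \<longrightarrow> (\<forall>bs\<in>tuples D k. F f bs \<in> D)))"

record 'd state =
  domain :: "'d set"
  input :: "'d db"
  aux_rel :: "nat \<Rightarrow> 'd list set"
  aux_fun :: "nat \<Rightarrow> 'd list \<Rightarrow> 'd"

definition sat_upd :: "'d state \<Rightarrow> 'd list \<Rightarrow> 'd list \<Rightarrow> upd_formula \<Rightarrow> bool" where
  "sat_upd \<S> as bs p \<longleftrightarrow>
     sat (domain \<S>) (aux_fun \<S>) (case_sum (input \<S>) (aux_rel \<S>)) (case_sum (nth as) (nth bs)) p"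

primrec eval_upd :: "'d state \<Rightarrow> 'd list \<Rightarrow> 'd list \<Rightarrow> upd_term \<Rightarrow> 'd" where
  "eval_upd \<S> as bs (UVar x) = case_sum (nth as) (nth bs) x"
| "eval_upd \<S> as bs (UFn f ts) = aux_fun \<S> f (map (eval_upd \<S> as bs) ts)"
| "eval_upd \<S> as bs (ITE p t u) =
     (if sat_upd \<S> as bs p then eval_upd \<S> as bs t else eval_upd \<S> as bs u)"

text \<open>All updates are evaluated in the state before the modification.\<close>

fun apply_modification :: "schema \<Rightarrow> update_program \<Rightarrow> 'd modification \<Rightarrow> 'd state \<Rightarrow> 'd state" where
  "apply_modification \<tau> P (\<delta>, S, as) \<S> =
     \<lparr>domain = domain \<S>,
      input = modify (\<delta>, S, as) (input \<S>),
      aux_rel = (\<lambda>R. {bs. \<exists>k. aux_rels \<tau> R = Some k \<and> bs \<in> tuples (domain \<S>) k \<and>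
                              sat_upd \<S> as bs (rel_upd P \<delta> S R)}),
      aux_fun = (\<lambda>f bs. eval_upd \<S> as bs (fun_upd_term P \<delta> S f))\<rparr>"

type_synonym 'd init = "'d set \<Rightarrow> 'd db \<Rightarrow> 'd aux"

definition init_state :: "'d init \<Rightarrow> 'd set \<Rightarrow> 'd db \<Rightarrow> 'd state" where
  "init_state Init D I =
     \<lparr>domain = D, input = I, aux_rel = fst (Init D I), aux_fun = snd (Init D I)\<rparr>"

definition is_init :: "schema \<Rightarrow> 'd init \<Rightarrow> bool" where
  "is_init \<tau> Init \<longleftrightarrow>
     (\<forall>D I. finite D \<and> D \<noteq> {} \<and> is_db (in_rels \<tau>) D I \<longrightarrow> is_aux \<tau> D (Init D I))"

definition dynprop_dynamic_program ::
    "schema \<Rightarrow> update_program \<Rightarrow> 'd init \<Rightarrow> nat \<Rightarrow> bool" where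
  "dynprop_dynamic_program \<tau> P Init Q \<longleftrightarrow>
     wf_schema \<tau> \<and> dynprop_program \<tau> P \<and> is_init \<tau> Init \<and> aux_rels \<tau> Q = Some 0"

definition maintains ::
    "schema \<Rightarrow> update_program \<Rightarrow> 'd init \<Rightarrow> nat \<Rightarrow> 'd boolean_query \<Rightarrow> bool" where
  "maintains \<tau> P Init Q q \<longleftrightarrow>
     (\<forall>D I \<alpha>. finite D \<and> D \<noteq> {} \<and> is_db (in_rels \<tau>) D I \<and>
        (\<forall>\<delta>\<in>set \<alpha>. is_modification (in_rels \<tau>) D \<delta>) \<longrightarrow>
        ([] \<in> aux_rel (fold (apply_modification \<tau> P) \<alpha> (init_state Init D I)) Q
          \<longleftrightarrow> q D (fold modify \<alpha> I)))"

end

theory Submission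
  imports Defs "HOL-Library.Nat_Bijection" Complex_Main
begin

text \<open>The query is \<open>\<exists>x. \<forall>y. U y \<longrightarrow> E x y\<close>. Each family of \<open>m\<close>-subsets of an \<open>n\<close>-element
  set \<open>Y\<close> is coded by a relation \<open>E\<close> in which every member of the family has its own witness \<open>x\<close>,
  so that inserting the elements of an \<open>m\<close>-set into the empty relation \<open>U\<close> tests membership
  in the family. The answer of a program after \<open>m\<close> insertions depends only on the truth, in the
  initial state, of atoms whose terms are built from elements of \<open>Y\<close> and have bounded depth. Unary
  functions leave only \<open>O(n)\<close> such terms, hence \<open>O(n\<^sup>r)\<close> atoms with \<open>r\<close> the maximal arity, and
  for \<open>m = r + 1\<close> and large \<open>n\<close> there are more families than truth assignments to these atoms.\<close>

section \<open>Terms and atoms of bounded depth\<close>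

primrec subst_trm :: "('v \<Rightarrow> ('f, 'w) trm) \<Rightarrow> ('f, 'v) trm \<Rightarrow> ('f, 'w) trm" where
  "subst_trm \<theta> (Var x) = \<theta> x"
| "subst_trm \<theta> (Fn f ts) = Fn f (map (subst_trm \<theta>) ts)"

lemma eval_subst_trm:
  "(\<And>x. x \<in> fv_trm t \<Longrightarrow> \<sigma> x = eval_trm F \<rho> (\<theta> x)) \<Longrightarrow>
    eval_trm F \<rho> (subst_trm \<theta> t) = eval_trm F \<sigma> t"
proof (induction t)
  case (Fn f ts)
  then have "map (eval_trm F \<rho>) (map (subst_trm \<theta>) ts) = map (eval_trm F \<sigma>) ts"
    by fastforce
  then show ?case unfolding subst_trm.simps eval_trm.simps by (rule arg_cong)
qed simp

text \<open>Levels are cumulative, so depth bounds may be weakened freely. The leaves are elements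
  of \<open>Y\<close>; a constant is an application to the empty list and first appears at level
  1.\<close>

primrec terms_upto :: "('f \<rightharpoonup> nat) \<Rightarrow> 'v set \<Rightarrow> nat \<Rightarrow> ('f, 'v) trm set" where
  "terms_upto far Y 0 = Var ` Y"
| "terms_upto far Y (Suc k) = terms_upto far Y k \<union>
     {Fn f ts |f ts. far f = Some (length ts) \<and> set ts \<subseteq> terms_upto far Y k}"

lemma terms_upto_mono: "k \<le> l \<Longrightarrow> terms_upto far Y k \<subseteq> terms_upto far Y l"
  by (rule lift_Suc_mono_le[of "terms_upto far Y"]) auto

lemma Var_in_terms_upto: "y \<in> Y \<Longrightarrow> Var y \<in> terms_upto far Y k"
  using terms_upto_mono[of 0 k far Y] by auto

definition atoms_upto ::
    "('f \<rightharpoonup> nat) \<Rightarrow> ('r \<rightharpoonup> nat) \<Rightarrow> 'v set \<Rightarrow> nat \<Rightarrow> ('f, 'r, 'v) fo set" where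
  "atoms_upto far rar Y k =
     {Eq s t |s t. s \<in> terms_upto far Y k \<and> t \<in> terms_upto far Y k} \<union>
     {Rel r ts |r ts. rar r = Some (length ts) \<and> set ts \<subseteq> terms_upto far Y k}"

lemma atoms_upto_mono: "k \<le> l \<Longrightarrow> atoms_upto far rar Y k \<subseteq> atoms_upto far rar Y l"
  using terms_upto_mono[of k l far Y] unfolding atoms_upto_def by blast

text \<open>The maximum of the individual bounds works for all, by monotonicity. This merges bounds
  over the arguments of a term and over the finitely many symbols of a schema.\<close>

lemma bounded_uniformly:
  fixes P :: "'a \<Rightarrow> nat \<Rightarrow> bool"
  assumes "finite A" and ex: "\<And>a. a \<in> A \<Longrightarrow> \<exists>c. P a c"
    and mono: "\<And>a c c'. P a c \<Longrightarrow> c \<le> c' \<Longrightarrow> P a c'"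
  shows "\<exists>c. \<forall>a\<in>A. P a c"
proof -
  obtain g where g: "\<And>a. a \<in> A \<Longrightarrow> P a (g a)"
    using ex by metis
  have "P a (Max (g ` A))" if "a \<in> A" for a
    using mono[OF g[OF that]] \<open>finite A\<close> that by simp
  then show ?thesis by blast
qed

section \<open>Growth of term depth under substitution\<close>

text \<open>The bound \<open>c\<close> is fixed before \<open>Y\<close>, \<open>e\<close> and
  \<open>\<theta>\<close>, hence may depend on \<open>t\<close> only. As \<open>'w\<close> occurs
  only under these inner quantifiers, the \<open>itself\<close> argument carries the type.\<close>

definition subst_bound ::
    "'w itself \<Rightarrow> ('f \<rightharpoonup> nat) \<Rightarrow> 'v set \<Rightarrow> ('f, 'v) trm \<Rightarrow> nat \<Rightarrow> bool" where
  "subst_bound _ far V t c \<longleftrightarrow> (\<forall>(Y :: 'w set) e \<theta>. \<theta> ` V \<subseteq> terms_upto far Y e \<longrightarrow>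
     subst_trm \<theta> t \<in> terms_upto far Y (c + e))"

lemma subst_bound_mono: "subst_bound w far V t c \<Longrightarrow> c \<le> c' \<Longrightarrow> subst_bound w far V t c'"
  unfolding subst_bound_def by (meson add_le_mono1 subsetD terms_upto_mono)

text \<open>The nesting depth of \<open>t\<close> serves as \<open>c\<close>: every function symbol
  adds one level on top of its arguments.\<close>

lemma ex_subst_bound:
  assumes "wf_trm far t" and "fv_trm t \<subseteq> V"
  shows "\<exists>c. subst_bound TYPE('w) far V t c"
  using assms
proof (induction t)
  case (Var x)
  then show ?case by (intro exI[of _ 0]) (auto simp: subst_bound_def)
next
  case (Fn f ts)
  have "\<exists>c. \<forall>t\<in>set ts. subst_bound TYPE('w) far V t c"
  proof (rule bounded_uniformly)
    show "\<exists>c. subst_bound TYPE('w) far V t c" if "t \<in> set ts" for t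
      using that Fn by (auto simp: UN_subset_iff)
  qed (auto intro: subst_bound_mono)
  then obtain c where "\<forall>t\<in>set ts. subst_bound TYPE('w) far V t c" ..
  then have "subst_bound TYPE('w) far V (Fn f ts) (Suc c)"
    using Fn.prems by (auto simp: subst_bound_def)
  then show ?case ..
qed

lemma ex_subst_bound_list:
  assumes "\<And>t. t \<in> set ts \<Longrightarrow> wf_trm far t \<and> fv_trm t \<subseteq> V"
  shows "\<exists>c. \<forall>t\<in>set ts. subst_bound TYPE('w) far V t c"
  by (rule bounded_uniformly) (auto intro: subst_bound_mono ex_subst_bound dest: assms)

section \<open>Counting terms and atoms\<close>

text \<open>This is where unary functions matter. With arity at most 1, each function symbol adds
  per level at most one term for the empty argument list and one for every earlier term. As
  \<open>Y\<close> is nonempty, the former is absorbed by the latter, so a level multiplies the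
  count by a constant and the total stays linear in \<open>card Y\<close>.\<close>

lemma card_terms_upto:
  assumes "finite (dom far)" and unary: "\<forall>k\<in>ran far. k \<le> 1" and "finite Y" and "Y \<noteq> {}"
  shows "finite (terms_upto far Y k) \<and>
    card (terms_upto far Y k) \<le> (1 + 2 * card (dom far)) ^ k * card Y"
proof (induction k)
  case 0
  then show ?case using \<open>finite Y\<close> by (simp add: card_image_le)
next
  case (Suc k)
  let ?T = "terms_upto far Y k"
  let ?L = "{ts. set ts \<subseteq> ?T \<and> length ts \<le> 1}"
  have fin: "finite ?T" using Suc by simp
  have "Var ` Y \<subseteq> ?T" by (auto intro: Var_in_terms_upto)
  then have pos: "1 \<le> card ?T"
    using \<open>Y \<noteq> {}\<close> fin by (metis One_nat_def Suc_leI card_gt_0_iff image_is_empty subset_empty)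
  have L: "finite ?L" "card ?L = 1 + card ?T"
    using finite_lists_length_le[OF fin, of 1] card_lists_length_le[OF fin, of 1] by simp_all
  have sub: "terms_upto far Y (Suc k) \<subseteq> ?T \<union> (\<lambda>(f, ts). Fn f ts) ` (dom far \<times> ?L)" (is "_ \<subseteq> ?B")
    using unary by (auto simp: ran_def image_iff)
  have finB: "finite ?B" using fin L assms(1) by simp
  have "card (terms_upto far Y (Suc k)) \<le> card ?B"
    using card_mono[OF finB sub] .
  also have "\<dots> \<le> card ?T + card (dom far \<times> ?L)"
    using fin L assms(1) by (intro order_trans[OF card_Un_le] add_mono card_image_le) auto
  also have "\<dots> = card ?T + card (dom far) * (1 + card ?T)"
    using L by (simp add: card_cartesian_product)
  also have "\<dots> \<le> card ?T + card (dom far) * (card ?T + card ?T)"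
    using pos by (intro add_mono mult_le_mono) auto
  also have "\<dots> = (1 + 2 * card (dom far)) * card ?T" by (simp add: algebra_simps)
  also have "\<dots> \<le> (1 + 2 * card (dom far)) * ((1 + 2 * card (dom far)) ^ k * card Y)"
    using Suc by (intro mult_le_mono) auto
  finally show ?case using finite_subset[OF sub finB] by (simp only: power_Suc mult.assoc)
qed

text \<open>An atom is an equality, with two terms, or a relation symbol with at most
  \<open>r\<close> terms, and the number of terms is linear in \<open>card Y\<close>. The condition
  \<open>2 \<le> r\<close> lets the equalities fit into the same power. \<open>K\<close> is uniform
  in \<open>Y\<close>.\<close>

lemma card_atoms_upto:
  assumes "finite (dom far)" and "\<forall>k\<in>ran far. k \<le> 1" and "finite (dom rar)"
    and arity: "\<forall>k\<in>ran rar. k \<le> r" and "2 \<le> r"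
  shows "\<exists>K. \<forall>Y. finite Y \<and> Y \<noteq> {} \<longrightarrow>
    finite (atoms_upto far rar Y k) \<and> card (atoms_upto far rar Y k) \<le> K * card Y ^ r"
proof -
  define C where "C = (1 + 2 * card (dom far)) ^ k"
  define K where "K = (1 + card (dom rar) * (r + 1)) * C ^ r"
  have "finite (atoms_upto far rar Y k) \<and> card (atoms_upto far rar Y k) \<le> K * card Y ^ r"
    if Y: "finite Y" "Y \<noteq> {}" for Y :: "'c set"
  proof -
    let ?T = "terms_upto far Y k"
    let ?L = "{ts. set ts \<subseteq> ?T \<and> length ts \<le> r}"
    let ?B = "(\<lambda>(s, t). Eq s t) ` (?T \<times> ?T) \<union> (\<lambda>(r, ts). Rel r ts) ` (dom rar \<times> ?L)"
    have fin: "finite ?T" and T: "card ?T \<le> C * card Y"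
      using card_terms_upto[OF assms(1,2) Y, of k] by (auto simp: C_def)
    have "Var ` Y \<subseteq> ?T" by (auto intro: Var_in_terms_upto)
    then have pos: "1 \<le> card ?T"
      using Y fin by (metis One_nat_def Suc_leI card_gt_0_iff image_is_empty subset_empty)
    have L: "finite ?L" "card ?L = (\<Sum>i\<le>r. card ?T ^ i)"
      using finite_lists_length_le[OF fin] card_lists_length_le[OF fin] by simp_all
    have "(\<Sum>i\<le>r. card ?T ^ i) \<le> (\<Sum>i\<le>r. card ?T ^ r)"
      using pos by (intro sum_mono power_increasing) auto
    then have cL: "card ?L \<le> (r + 1) * card ?T ^ r" using L by simp
    have sub: "atoms_upto far rar Y k \<subseteq> ?B"
      using arity by (auto simp: atoms_upto_def ran_def image_iff)
    have finB: "finite ?B" using fin L assms(3) by simp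
    have "card (atoms_upto far rar Y k) \<le> card ?B" using card_mono[OF finB sub] .
    also have "\<dots> \<le> card (?T \<times> ?T) + card (dom rar \<times> ?L)"
      using fin L assms(3) by (intro order_trans[OF card_Un_le] add_mono card_image_le) auto
    also have "\<dots> = card ?T ^ 2 + card (dom rar) * card ?L"
      by (simp add: card_cartesian_product power2_eq_square)
    also have "\<dots> \<le> card ?T ^ r + card (dom rar) * ((r + 1) * card ?T ^ r)"
      using pos \<open>2 \<le> r\<close> cL by (intro add_mono mult_le_mono power_increasing) auto
    also have "\<dots> = (1 + card (dom rar) * (r + 1)) * card ?T ^ r" by (simp add: algebra_simps)
    also have "\<dots> \<le> (1 + card (dom rar) * (r + 1)) * (C * card Y) ^ r"
      using T by (intro mult_le_mono power_mono) auto
    also have "\<dots> = K * card Y ^ r" by (simp add: K_def power_mult_distrib algebra_simps)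
    finally show ?thesis using finite_subset[OF sub finB] by simp
  qed
  then show ?thesis by blast
qed

section \<open>States agreeing on atoms of bounded depth\<close>

text \<open>Domain elements serve as variables that denote themselves.\<close>

abbreviation (input) value_of :: "'d state \<Rightarrow> (nat, 'd) trm \<Rightarrow> 'd" where
  "value_of \<S> \<equiv> eval_trm (aux_fun \<S>) id"

abbreviation (input) all_rels :: "schema \<Rightarrow> nat + nat \<rightharpoonup> nat" where
  "all_rels \<tau> \<equiv> case_sum (in_rels \<tau>) (aux_rels \<tau>)"

definition holds :: "'d state \<Rightarrow> (nat, nat + nat, 'd) fo \<Rightarrow> bool" where
  "holds \<S> p \<longleftrightarrow> sat (domain \<S>) (aux_fun \<S>) (case_sum (input \<S>) (aux_rel \<S>)) id p"

text \<open>States are compared through names: one term may denote different elements in the two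
  states. The first conjunct is there because updated auxiliary relations are cut down to tuples
  over the domain.\<close>

definition agree :: "schema \<Rightarrow> 'd set \<Rightarrow> nat \<Rightarrow> 'd state \<Rightarrow> 'd state \<Rightarrow> bool" where
  "agree \<tau> Y k \<S> \<S>' \<longleftrightarrow>
     (\<forall>t\<in>terms_upto (aux_funs \<tau>) Y k. value_of \<S> t \<in> domain \<S> \<and> value_of \<S>' t \<in> domain \<S>') \<and>
     (\<forall>a\<in>atoms_upto (aux_funs \<tau>) (all_rels \<tau>) Y k. holds \<S> a \<longleftrightarrow> holds \<S>' a)"

lemma agree_antimono: "agree \<tau> Y l \<S> \<S>' \<Longrightarrow> k \<le> l \<Longrightarrow> agree \<tau> Y k \<S> \<S>'"
  unfolding agree_def by (meson atoms_upto_mono subsetD terms_upto_mono)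

lemma agree_domain:
  "agree \<tau> Y k \<S> \<S>' \<Longrightarrow> t \<in> terms_upto (aux_funs \<tau>) Y k \<Longrightarrow>
    value_of \<S> t \<in> domain \<S> \<and> value_of \<S>' t \<in> domain \<S>'"
  unfolding agree_def by blast

lemma agree_Eq:
  assumes "agree \<tau> Y k \<S> \<S>'"
    and "s \<in> terms_upto (aux_funs \<tau>) Y k" "t \<in> terms_upto (aux_funs \<tau>) Y k"
  shows "value_of \<S> s = value_of \<S> t \<longleftrightarrow> value_of \<S>' s = value_of \<S>' t"
proof -
  have "Eq s t \<in> atoms_upto (aux_funs \<tau>) (all_rels \<tau>) Y k"
    using assms(2,3) by (auto simp: atoms_upto_def)
  then have "holds \<S> (Eq s t) \<longleftrightarrow> holds \<S>' (Eq s t)"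
    using assms(1) by (simp add: agree_def)
  then show ?thesis by (simp add: holds_def)
qed

text \<open>Lets both states decide alike whether a tuple is the one being inserted or
  deleted.\<close>

lemma agree_map_eq:
  assumes "agree \<tau> Y k \<S> \<S>'"
    and "set ss \<subseteq> terms_upto (aux_funs \<tau>) Y k" "set ts \<subseteq> terms_upto (aux_funs \<tau>) Y k"
  shows "map (value_of \<S>) ss = map (value_of \<S>) ts \<longleftrightarrow> map (value_of \<S>') ss = map (value_of \<S>') ts"
proof -
  have "value_of \<S> (ss ! i) = value_of \<S> (ts ! i) \<longleftrightarrow> value_of \<S>' (ss ! i) = value_of \<S>' (ts ! i)"
    if "i < length ss" "i < length ts" for i
    using that assms(2,3) by (intro agree_Eq[OF assms(1)]) (auto dest: nth_mem)
  then show ?thesis unfolding list_eq_iff_nth_eq by auto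
qed

lemma agree_Rel:
  assumes "agree \<tau> Y k \<S> \<S>'" and "all_rels \<tau> r = Some (length ts)"
    and "set ts \<subseteq> terms_upto (aux_funs \<tau>) Y k"
  shows "map (value_of \<S>) ts \<in> case_sum (input \<S>) (aux_rel \<S>) r \<longleftrightarrow>
    map (value_of \<S>') ts \<in> case_sum (input \<S>') (aux_rel \<S>') r"
proof -
  have "Rel r ts \<in> atoms_upto (aux_funs \<tau>) (all_rels \<tau>) Y k"
    using assms(2,3) by (auto simp: atoms_upto_def)
  then have "holds \<S> (Rel r ts) \<longleftrightarrow> holds \<S>' (Rel r ts)"
    using assms(1) by (simp add: agree_def)
  then show ?thesis by (simp add: holds_def)
qed

lemma agreeI:
  assumes "\<And>t. t \<in> terms_upto (aux_funs \<tau>) Y k \<Longrightarrow>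
      value_of \<S> t \<in> domain \<S> \<and> value_of \<S>' t \<in> domain \<S>'"
    and "\<And>s t. s \<in> terms_upto (aux_funs \<tau>) Y k \<Longrightarrow> t \<in> terms_upto (aux_funs \<tau>) Y k \<Longrightarrow>
      value_of \<S> s = value_of \<S> t \<longleftrightarrow> value_of \<S>' s = value_of \<S>' t"
    and "\<And>r ts. all_rels \<tau> r = Some (length ts) \<Longrightarrow> set ts \<subseteq> terms_upto (aux_funs \<tau>) Y k \<Longrightarrow>
      map (value_of \<S>) ts \<in> case_sum (input \<S>) (aux_rel \<S>) r \<longleftrightarrow>
      map (value_of \<S>') ts \<in> case_sum (input \<S>') (aux_rel \<S>') r"
  shows "agree \<tau> Y k \<S> \<S>'"
  unfolding agree_def
proof (intro conjI ballI)
  fix a assume "a \<in> atoms_upto (aux_funs \<tau>) (all_rels \<tau>) Y k"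
  then consider s t where "a = Eq s t" "s \<in> terms_upto (aux_funs \<tau>) Y k" "t \<in> terms_upto (aux_funs \<tau>) Y k"
    | r ts where "a = Rel r ts" "all_rels \<tau> r = Some (length ts)" "set ts \<subseteq> terms_upto (aux_funs \<tau>) Y k"
    unfolding atoms_upto_def by blast
  then show "holds \<S> a \<longleftrightarrow> holds \<S>' a"
    by cases (use assms(2,3) in \<open>simp_all add: holds_def\<close>)
qed (use assms(1) in blast)+

section \<open>Updates\<close>

text \<open>The assignment \<open>(x; y) \<mapsto> (as; bs)\<close> as a substitution, where \<open>bs\<close> are the values of \<open>us\<close>.\<close>

definition upd_subst :: "'d list \<Rightarrow> (nat, 'd) trm list \<Rightarrow> nat + nat \<Rightarrow> (nat, 'd) trm" where
  "upd_subst as us = case_sum (\<lambda>i. Var (as ! i)) (\<lambda>j. us ! j)"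

lemma value_of_upd_subst:
  assumes "x \<in> {..<length as} <+> {..<length us}"
  shows "case_sum (nth as) (nth (map (value_of \<S>) us)) x = value_of \<S> (upd_subst as us x)"
  using assms by (auto simp: upd_subst_def split: sum.splits)

lemma upd_subst_in_terms_upto:
  assumes "as \<in> tuples Y m" and "us \<in> tuples (terms_upto far Y e) n"
  shows "upd_subst as us ` ({..<m} <+> {..<n}) \<subseteq> terms_upto far Y e"
proof -
  have "as ! i \<in> Y" if "i < m" for i
    using assms(1) that by (auto simp: tuples_def)
  moreover have "us ! j \<in> terms_upto far Y e" if "j < n" for j
    using assms(2) that by (auto simp: tuples_def)
  ultimately show ?thesis
    by (auto simp: upd_subst_def intro!: Var_in_terms_upto)
qed

text \<open>\<open>upd_formula_bound\<close> and \<open>upd_term_bound\<close> say that going through an update costs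
  at most \<open>c\<close> levels of term depth, uniformly in the states and in \<open>Y\<close>. In the second one, the same
  term \<open>u\<close> works for both states.\<close>

definition upd_formula_bound ::
    "'d itself \<Rightarrow> schema \<Rightarrow> nat \<Rightarrow> nat \<Rightarrow> upd_formula \<Rightarrow> nat \<Rightarrow> bool" where
  "upd_formula_bound _ \<tau> m n p c \<longleftrightarrow>
     (\<forall>(Y :: 'd set) e \<S> \<S>'. \<forall>as\<in>tuples Y m. \<forall>us\<in>tuples (terms_upto (aux_funs \<tau>) Y e) n.
        agree \<tau> Y (c + e) \<S> \<S>' \<longrightarrow>
        (sat_upd \<S> as (map (value_of \<S>) us) p \<longleftrightarrow> sat_upd \<S>' as (map (value_of \<S>') us) p))"

definition upd_term_bound ::
    "'d itself \<Rightarrow> schema \<Rightarrow> nat \<Rightarrow> nat \<Rightarrow> upd_term \<Rightarrow> nat \<Rightarrow> bool" where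
  "upd_term_bound _ \<tau> m n t c \<longleftrightarrow>
     (\<forall>(Y :: 'd set) e \<S> \<S>'. \<forall>as\<in>tuples Y m. \<forall>us\<in>tuples (terms_upto (aux_funs \<tau>) Y e) n.
        agree \<tau> Y (c + e) \<S> \<S>' \<longrightarrow>
        (\<exists>u\<in>terms_upto (aux_funs \<tau>) Y (c + e).
           eval_upd \<S> as (map (value_of \<S>) us) t = value_of \<S> u \<and>
           eval_upd \<S>' as (map (value_of \<S>') us) t = value_of \<S>' u))"

lemma upd_formula_bound_mono:
  assumes "upd_formula_bound d \<tau> m n p c" and "c \<le> c'"
  shows "upd_formula_bound d \<tau> m n p c'"
  unfolding upd_formula_bound_def
proof (intro allI ballI impI, goal_cases)
  case (1 Y e \<S> \<S>' as us)
  have "agree \<tau> Y (c + e) \<S> \<S>'"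
    using 1(3) assms(2) by (rule agree_antimono[OF _ add_le_mono1])
  with assms(1) 1 show ?case
    by (simp add: upd_formula_bound_def)
qed

lemma upd_term_bound_mono:
  assumes "upd_term_bound d \<tau> m n t c" and "c \<le> c'"
  shows "upd_term_bound d \<tau> m n t c'"
  unfolding upd_term_bound_def
proof (intro allI ballI impI, goal_cases)
  case (1 Y e \<S> \<S>' as us)
  have "c + e \<le> c' + e" using assms(2) by simp
  with assms(1) 1 show ?case
    unfolding upd_term_bound_def
    using agree_antimono[OF 1(3) \<open>c + e \<le> c' + e\<close>]
      terms_upto_mono[OF \<open>c + e \<le> c' + e\<close>, of "aux_funs \<tau>" Y] by blast
qed

lemma eval_upd_subst:
  assumes "as \<in> tuples Y m" and "us \<in> tuples T n" and "fv_trm t \<subseteq> {..<m} <+> {..<n}"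
  shows "eval_trm (aux_fun \<S>) (case_sum (nth as) (nth (map (value_of \<S>) us))) t =
    value_of \<S> (subst_trm (upd_subst as us) t)"
proof (rule eval_subst_trm[symmetric])
  have "length as = m" "length us = n" using assms(1,2) by (auto simp: tuples_def)
  then show "case_sum (nth as) (nth (map (value_of \<S>) us)) x = value_of \<S> (upd_subst as us x)"
    if "x \<in> fv_trm t" for x
    using assms(3) that by (intro value_of_upd_subst) blast
qed

text \<open>Substituting \<open>as\<close> and \<open>us\<close> for the variables turns each atom
  of \<open>p\<close> into an atom over \<open>Y\<close> of depth at most \<open>c + e\<close>, on
  which the states agree. Connectives take the maximum of the bounds. A quantifier would reach
  elements without a name, which is why \<open>p\<close> has to be quantifier-free.\<close>

lemma ex_upd_formula_bound:
  assumes "wf_upd_formula \<tau> m n p"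
  shows "\<exists>c. upd_formula_bound TYPE('d) \<tau> m n p c"
proof -
  let ?V = "{..<m} <+> {..<n}"
  have "\<exists>c. upd_formula_bound TYPE('d) \<tau> m n p c"
    if "qfree p" "wf_fo (aux_funs \<tau>) (all_rels \<tau>) p" "fv_fo p \<subseteq> ?V" for p
    using that
  proof (induction p)
    case Bot
    then show ?case by (simp add: upd_formula_bound_def sat_upd_def)
  next
    case (Eq s t)
    obtain c where c: "\<forall>t'\<in>set [s, t]. subst_bound TYPE('d) (aux_funs \<tau>) ?V t' c"
      using ex_subst_bound_list[of "[s, t]" "aux_funs \<tau>" ?V] Eq.prems by auto
    have "upd_formula_bound TYPE('d) \<tau> m n (Eq s t) c"
      unfolding upd_formula_bound_def
    proof (intro allI ballI impI)
      fix Y :: "'d set" and e \<S> \<S>' as us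
      assume as: "as \<in> tuples Y m" and us: "us \<in> tuples (terms_upto (aux_funs \<tau>) Y e) n"
        and agr: "agree \<tau> Y (c + e) \<S> \<S>'"
      have "subst_trm (upd_subst as us) s \<in> terms_upto (aux_funs \<tau>) Y (c + e)"
        "subst_trm (upd_subst as us) t \<in> terms_upto (aux_funs \<tau>) Y (c + e)"
        using c upd_subst_in_terms_upto[OF as us] by (auto simp: subst_bound_def)
      moreover have "fv_trm s \<subseteq> ?V" "fv_trm t \<subseteq> ?V" using Eq.prems by auto
      note this[THEN eval_upd_subst[OF as us]]
      ultimately show "sat_upd \<S> as (map (value_of \<S>) us) (Eq s t) \<longleftrightarrow>
          sat_upd \<S>' as (map (value_of \<S>') us) (Eq s t)"
        using agree_Eq[OF agr] by (simp only: sat_upd_def sat.simps)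
    qed
    then show ?case ..
  next
    case (Rel r ts)
    obtain c where c: "\<forall>t\<in>set ts. subst_bound TYPE('d) (aux_funs \<tau>) ?V t c"
      using ex_subst_bound_list[of ts "aux_funs \<tau>" ?V] Rel.prems by (auto simp: UN_subset_iff)
    have "upd_formula_bound TYPE('d) \<tau> m n (Rel r ts) c"
      unfolding upd_formula_bound_def
    proof (intro allI ballI impI)
      fix Y :: "'d set" and e \<S> \<S>' as us
      assume as: "as \<in> tuples Y m" and us: "us \<in> tuples (terms_upto (aux_funs \<tau>) Y e) n"
        and agr: "agree \<tau> Y (c + e) \<S> \<S>'"
      have ev: "map (eval_trm (aux_fun \<T>) (case_sum (nth as) (nth (map (value_of \<T>) us)))) ts =
          map (value_of \<T>) (map (subst_trm (upd_subst as us)) ts)" for \<T>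
        using Rel.prems by (auto simp: UN_subset_iff intro!: eval_upd_subst[OF as us])
      let ?ts = "map (subst_trm (upd_subst as us)) ts"
      have "set ?ts \<subseteq> terms_upto (aux_funs \<tau>) Y (c + e)"
        using c upd_subst_in_terms_upto[OF as us] by (auto simp: subst_bound_def)
      then show "sat_upd \<S> as (map (value_of \<S>) us) (Rel r ts) \<longleftrightarrow>
          sat_upd \<S>' as (map (value_of \<S>') us) (Rel r ts)"
        using agree_Rel[OF agr, of r ?ts] Rel.prems
        unfolding sat_upd_def sat.simps ev by simp
    qed
    then show ?case ..
  next
    case (Neg p)
    then show ?case by (simp add: upd_formula_bound_def sat_upd_def)
  next
    case (Conj p q)
    then obtain c c' where "upd_formula_bound TYPE('d) \<tau> m n p c" "upd_formula_bound TYPE('d) \<tau> m n q c'"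
      by auto
    then have "upd_formula_bound TYPE('d) \<tau> m n p (max c c')" "upd_formula_bound TYPE('d) \<tau> m n q (max c c')"
      by (auto elim: upd_formula_bound_mono)
    then have "upd_formula_bound TYPE('d) \<tau> m n (Conj p q) (max c c')"
      by (simp add: upd_formula_bound_def sat_upd_def)
    then show ?case ..
  next
    case (Disj p q)
    then obtain c c' where "upd_formula_bound TYPE('d) \<tau> m n p c" "upd_formula_bound TYPE('d) \<tau> m n q c'"
      by auto
    then have "upd_formula_bound TYPE('d) \<tau> m n p (max c c')" "upd_formula_bound TYPE('d) \<tau> m n q (max c c')"
      by (auto elim: upd_formula_bound_mono)
    then have "upd_formula_bound TYPE('d) \<tau> m n (Disj p q) (max c c')"
      by (simp add: upd_formula_bound_def sat_upd_def)
    then show ?case ..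
  qed simp_all
  then show ?thesis using assms by (simp add: wf_upd_formula_def)
qed

text \<open>A function symbol costs one level. For \<open>ITE\<close>, the guard has the same truth
  value in both states, so both take the same branch and one term \<open>u\<close> can name the
  result in both.\<close>

lemma ex_upd_term_bound:
  assumes "wf_upd_term \<tau> m n t"
  shows "\<exists>c. upd_term_bound TYPE('d) \<tau> m n t c"
  using assms
proof (induction t)
  case (UVar x)
  have "upd_term_bound TYPE('d) \<tau> m n (UVar x) 0"
    unfolding upd_term_bound_def
  proof (intro allI ballI impI)
    fix Y :: "'d set" and e \<S> \<S>' as us
    assume as: "as \<in> tuples Y m" and us: "us \<in> tuples (terms_upto (aux_funs \<tau>) Y e) n"
    have x: "x \<in> {..<length as} <+> {..<length us}"
      using UVar as us by (simp add: tuples_def)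
    have "upd_subst as us x \<in> terms_upto (aux_funs \<tau>) Y (0 + e)"
      using upd_subst_in_terms_upto[OF as us] UVar by auto
    then show "\<exists>u\<in>terms_upto (aux_funs \<tau>) Y (0 + e).
        eval_upd \<S> as (map (value_of \<S>) us) (UVar x) = value_of \<S> u \<and>
        eval_upd \<S>' as (map (value_of \<S>') us) (UVar x) = value_of \<S>' u"
      unfolding eval_upd.simps value_of_upd_subst[OF x] by blast
  qed
  then show ?case ..
next
  case (UFn f ts)
  have "\<exists>c. \<forall>t\<in>set ts. upd_term_bound TYPE('d) \<tau> m n t c"
    by (rule bounded_uniformly) (use UFn upd_term_bound_mono in auto)
  then obtain c where c: "\<And>t. t \<in> set ts \<Longrightarrow> upd_term_bound TYPE('d) \<tau> m n t c" by blast
  have "upd_term_bound TYPE('d) \<tau> m n (UFn f ts) (Suc c)"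
    unfolding upd_term_bound_def
  proof (intro allI ballI impI)
    fix Y :: "'d set" and e \<S> \<S>' as us
    assume as: "as \<in> tuples Y m" and us: "us \<in> tuples (terms_upto (aux_funs \<tau>) Y e) n"
      and "agree \<tau> Y (Suc c + e) \<S> \<S>'"
    then have agr: "agree \<tau> Y (c + e) \<S> \<S>'" by (auto elim: agree_antimono)
    have "\<exists>u\<in>terms_upto (aux_funs \<tau>) Y (c + e).
        eval_upd \<S> as (map (value_of \<S>) us) t = value_of \<S> u \<and>
        eval_upd \<S>' as (map (value_of \<S>') us) t = value_of \<S>' u" if "t \<in> set ts" for t
      using c[OF that] as us agr unfolding upd_term_bound_def by blast
    then obtain g where g: "\<And>t. t \<in> set ts \<Longrightarrow> g t \<in> terms_upto (aux_funs \<tau>) Y (c + e) \<and>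
        eval_upd \<S> as (map (value_of \<S>) us) t = value_of \<S> (g t) \<and>
        eval_upd \<S>' as (map (value_of \<S>') us) t = value_of \<S>' (g t)"
      by metis
    have "Fn f (map g ts) \<in> terms_upto (aux_funs \<tau>) Y (Suc c + e)"
      using g UFn.prems by auto
    moreover have "eval_upd \<S> as (map (value_of \<S>) us) (UFn f ts) = value_of \<S> (Fn f (map g ts))"
      "eval_upd \<S>' as (map (value_of \<S>') us) (UFn f ts) = value_of \<S>' (Fn f (map g ts))"
      using g by (auto simp: comp_def intro!: arg_cong[where f = "aux_fun _ f"])
    ultimately show "\<exists>u\<in>terms_upto (aux_funs \<tau>) Y (Suc c + e).
        eval_upd \<S> as (map (value_of \<S>) us) (UFn f ts) = value_of \<S> u \<and>
        eval_upd \<S>' as (map (value_of \<S>') us) (UFn f ts) = value_of \<S>' u"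
      by blast
  qed
  then show ?case ..
next
  case (ITE p t u)
  obtain c1 c2 c3 where "upd_formula_bound TYPE('d) \<tau> m n p c1"
    "upd_term_bound TYPE('d) \<tau> m n t c2" "upd_term_bound TYPE('d) \<tau> m n u c3"
    using ITE ex_upd_formula_bound by (metis wf_upd_term.simps(3))
  then have "upd_formula_bound TYPE('d) \<tau> m n p (c1 + c2 + c3)"
    "upd_term_bound TYPE('d) \<tau> m n t (c1 + c2 + c3)" "upd_term_bound TYPE('d) \<tau> m n u (c1 + c2 + c3)"
    by (auto elim: upd_formula_bound_mono upd_term_bound_mono)
  then have "upd_term_bound TYPE('d) \<tau> m n (ITE p t u) (c1 + c2 + c3)"
    unfolding upd_term_bound_def upd_formula_bound_def eval_upd.simps by (smt (verit))
  then show ?case ..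
qed

section \<open>Agreement through sequences of modifications\<close>

text \<open>Atoms of the new states are pulled back to the old ones: a term is replaced by an old
  term with the same value, chosen jointly for both states, and a relation by its update formula.
  Only the depth grows, by an amount independent of \<open>Y\<close>, the states and the
  tuple.\<close>

lemma agree_apply_modification:
  fixes \<tau> :: schema and d :: nat
  assumes "wf_schema \<tau>" and "dynprop_program \<tau> P" and S: "in_rels \<tau> S = Some m"
  shows "\<exists>e. \<forall>(Y :: 'd set) \<S> \<S>'. \<forall>as\<in>tuples Y m. agree \<tau> Y e \<S> \<S>' \<longrightarrow>
    agree \<tau> Y d (apply_modification \<tau> P (\<delta>, S, as) \<S>) (apply_modification \<tau> P (\<delta>, S, as) \<S>')"
proof -
  have "\<exists>c. \<forall>R\<in>dom (aux_rels \<tau>).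
      upd_formula_bound TYPE('d) \<tau> m (the (aux_rels \<tau> R)) (rel_upd P \<delta> S R) c"
    using assms by (intro bounded_uniformly)
      (auto simp: wf_schema_def dynprop_program_def intro: ex_upd_formula_bound upd_formula_bound_mono)
  then obtain c1 where "\<forall>R\<in>dom (aux_rels \<tau>).
      upd_formula_bound TYPE('d) \<tau> m (the (aux_rels \<tau> R)) (rel_upd P \<delta> S R) c1" ..
  then have c1: "upd_formula_bound TYPE('d) \<tau> m n (rel_upd P \<delta> S R) c1"
    if "aux_rels \<tau> R = Some n" for R n
    using that by (metis domI option.sel)
  have "\<exists>c. \<forall>f\<in>dom (aux_funs \<tau>).
      upd_term_bound TYPE('d) \<tau> m (the (aux_funs \<tau> f)) (fun_upd_term P \<delta> S f) c"
    using assms by (intro bounded_uniformly)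
      (auto simp: wf_schema_def dynprop_program_def intro: ex_upd_term_bound upd_term_bound_mono)
  then obtain c2 where "\<forall>f\<in>dom (aux_funs \<tau>).
      upd_term_bound TYPE('d) \<tau> m (the (aux_funs \<tau> f)) (fun_upd_term P \<delta> S f) c2" ..
  then have c2: "upd_term_bound TYPE('d) \<tau> m n (fun_upd_term P \<delta> S f) c2"
    if "aux_funs \<tau> f = Some n" for f n
    using that by (metis domI option.sel)
  \<comment> \<open>Each of up to \<open>d\<close> nested function symbols costs \<open>c2\<close>
    levels; the update formula of the outermost relation symbol costs another
    \<open>c1\<close>.\<close>
  define e where "e = c1 + c2 * d"
  have "agree \<tau> Y d (apply_modification \<tau> P (\<delta>, S, as) \<S>) (apply_modification \<tau> P (\<delta>, S, as) \<S>')"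
    if as: "as \<in> tuples Y m" and agr: "agree \<tau> Y e \<S> \<S>'" for Y :: "'d set" and \<S> \<S>' as
  proof -
    define \<U> where "\<U> = apply_modification \<tau> P (\<delta>, S, as) \<S>"
    define \<U>' where "\<U>' = apply_modification \<tau> P (\<delta>, S, as) \<S>'"
    note U = \<U>_def \<U>'_def
    let ?T = "terms_upto (aux_funs \<tau>) Y"
    \<comment> \<open>Pull-back of terms: what a term of depth \<open>k\<close> denotes after the
      modification was named by a term of depth \<open>c2 * k\<close> before it, the same one for
      both states.\<close>
    have pre: "\<exists>u\<in>?T (c2 * k). value_of \<U> t = value_of \<S> u \<and> value_of \<U>' t = value_of \<S>' u"
      if "t \<in> ?T k" "k \<le> d" for t k
      using that
    proof (induction k arbitrary: t)
      case 0
      then show ?case by auto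
    next
      case (Suc k)
      show ?case
      proof (cases "t \<in> ?T k")
        case True
        then show ?thesis
          using Suc terms_upto_mono[of "c2 * k" "c2 * Suc k" "aux_funs \<tau>" Y] by fastforce
      next
        case False
        then obtain f ts where t: "t = Fn f ts" and f: "aux_funs \<tau> f = Some (length ts)"
          and ts: "set ts \<subseteq> ?T k"
          using Suc.prems by auto
        have "\<exists>u\<in>?T (c2 * k). value_of \<U> t = value_of \<S> u \<and> value_of \<U>' t = value_of \<S>' u"
          if "t \<in> set ts" for t
          using Suc.IH[OF _ Suc_leD[OF Suc.prems(2)]] ts that by blast
        then obtain g where g: "\<And>t. t \<in> set ts \<Longrightarrow> g t \<in> ?T (c2 * k) \<and>
            value_of \<U> t = value_of \<S> (g t) \<and> value_of \<U>' t = value_of \<S>' (g t)"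
          by metis
        then have ev: "map (value_of \<U>) ts = map (value_of \<S>) (map g ts)"
          "map (value_of \<U>') ts = map (value_of \<S>') (map g ts)" by auto
        have us: "map g ts \<in> tuples (?T (c2 * k)) (length ts)" using g by (auto simp: tuples_def)
        have "c2 + c2 * k \<le> e" unfolding e_def using Suc.prems(2)
          by (metis add_leD2 le_add2 mult_Suc_right mult_le_mono2 order_trans)
        then have "agree \<tau> Y (c2 + c2 * k) \<S> \<S>'" using agr agree_antimono by blast
        then obtain u where "u \<in> ?T (c2 + c2 * k)"
          "eval_upd \<S> as (map (value_of \<S>) (map g ts)) (fun_upd_term P \<delta> S f) = value_of \<S> u"
          "eval_upd \<S>' as (map (value_of \<S>') (map g ts)) (fun_upd_term P \<delta> S f) = value_of \<S>' u"
          using c2[OF f] as us unfolding upd_term_bound_def by blast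
        moreover have "aux_fun \<U> f bs = eval_upd \<S> as bs (fun_upd_term P \<delta> S f)"
          "aux_fun \<U>' f bs = eval_upd \<S>' as bs (fun_upd_term P \<delta> S f)" for bs
          by (simp_all add: U)
        ultimately show ?thesis unfolding t eval_trm.simps ev mult_Suc_right by metis
      qed
    qed
    obtain g where g: "\<And>t. t \<in> ?T d \<Longrightarrow> g t \<in> ?T (c2 * d) \<and>
        value_of \<U> t = value_of \<S> (g t) \<and> value_of \<U>' t = value_of \<S>' (g t)"
      using pre[OF _ order_refl] by metis
    have agr': "agree \<tau> Y (c2 * d) \<S> \<S>'" using agr by (rule agree_antimono) (simp add: e_def)
    have "agree \<tau> Y d \<U> \<U>'"
    proof (rule agreeI)
      show "value_of \<U> t \<in> domain \<U> \<and> value_of \<U>' t \<in> domain \<U>'" if "t \<in> ?T d" for t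
        using g[OF that] agree_domain[OF agr'] by (simp add: U)
      show "value_of \<U> s = value_of \<U> t \<longleftrightarrow> value_of \<U>' s = value_of \<U>' t"
        if "s \<in> ?T d" "t \<in> ?T d" for s t
        using g[OF that(1)] g[OF that(2)] agree_Eq[OF agr'] by simp
      fix r ts assume r: "all_rels \<tau> r = Some (length ts)" and ts: "set ts \<subseteq> ?T d"
      let ?us = "map g ts"
      have ev: "map (value_of \<U>) ts = map (value_of \<S>) ?us"
        "map (value_of \<U>') ts = map (value_of \<S>') ?us" using g ts by auto
      have us: "set ?us \<subseteq> ?T (c2 * d)" using g ts by auto
      show "map (value_of \<U>) ts \<in> case_sum (input \<U>) (aux_rel \<U>) r \<longleftrightarrow>
          map (value_of \<U>') ts \<in> case_sum (input \<U>') (aux_rel \<U>') r"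
      proof (cases r)
        case (Inl S')
        have old: "map (value_of \<S>) ?us \<in> input \<S> S' \<longleftrightarrow> map (value_of \<S>') ?us \<in> input \<S>' S'"
          using agree_Rel[OF agr', of r ?us] r us Inl by simp
        \<comment> \<open>The modified tuple is named by variables from \<open>Y\<close>, so being
          equal to it amounts to equality atoms. Together with old membership this determines new
          membership.\<close>
        have "set (map Var as) \<subseteq> ?T (c2 * d)"
          using as by (auto simp: tuples_def intro: Var_in_terms_upto)
        moreover have "map (value_of \<S>) (map Var as) = as" "map (value_of \<S>') (map Var as) = as"
          by (simp_all add: map_idI)
        ultimately have "map (value_of \<S>) ?us = as \<longleftrightarrow> map (value_of \<S>') ?us = as"
          using agree_map_eq[OF agr' us, of "map Var as"] by metis
        then show ?thesis
          unfolding ev using old Inl by (cases \<delta>) (auto simp: U)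
      next
        case (Inr R)
        have R: "aux_rels \<tau> R = Some (length ts)" using r Inr by simp
        \<comment> \<open>The restriction to tuples over the domain is met on both sides, so only
          the update formula decides.\<close>
        have "map (value_of \<S>) ?us \<in> tuples (domain \<S>) (length ts)"
          "map (value_of \<S>') ?us \<in> tuples (domain \<S>') (length ts)"
          using us agree_domain[OF agr'] by (auto simp: tuples_def)
        moreover have "?us \<in> tuples (?T (c2 * d)) (length ts)" using us by (simp add: tuples_def)
        then have "sat_upd \<S> as (map (value_of \<S>) ?us) (rel_upd P \<delta> S R) \<longleftrightarrow>
            sat_upd \<S>' as (map (value_of \<S>') ?us) (rel_upd P \<delta> S R)"
          using c1[OF R] as agr unfolding upd_formula_bound_def e_def by blast
        ultimately show ?thesis
          unfolding ev using Inr R by (simp add: U)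
      qed
    qed
    then show ?thesis by (simp add: U)
  qed
  then show ?thesis by blast
qed

text \<open>Induction on the number of modifications: the depth \<open>d\<close> that the last
  \<open>l\<close> of them require is the target depth for the first. Depth 0 at the end suffices
  for reading off a 0-ary query symbol.\<close>

lemma agree_apply_modifications:
  assumes "wf_schema \<tau>" and "dynprop_program \<tau> P" and "in_rels \<tau> S = Some m"
  shows "\<exists>e. \<forall>(Y :: 'd set) \<S> \<S>' ass. length ass = l \<and> set ass \<subseteq> tuples Y m \<and> agree \<tau> Y e \<S> \<S>' \<longrightarrow>
    agree \<tau> Y 0 (fold (apply_modification \<tau> P) (map (\<lambda>as. (\<delta>, S, as)) ass) \<S>)
      (fold (apply_modification \<tau> P) (map (\<lambda>as. (\<delta>, S, as)) ass) \<S>')"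
proof (induction l)
  case 0
  then show ?case by (intro exI[of _ 0]) auto
next
  case (Suc l)
  then obtain d where d: "\<And>(Y :: 'd set) \<S> \<S>' ass. length ass = l \<Longrightarrow> set ass \<subseteq> tuples Y m \<Longrightarrow>
    agree \<tau> Y d \<S> \<S>' \<Longrightarrow>
    agree \<tau> Y 0 (fold (apply_modification \<tau> P) (map (\<lambda>as. (\<delta>, S, as)) ass) \<S>)
      (fold (apply_modification \<tau> P) (map (\<lambda>as. (\<delta>, S, as)) ass) \<S>')" by blast
  obtain e where e: "\<And>(Y :: 'd set) \<S> \<S>' as. as \<in> tuples Y m \<Longrightarrow> agree \<tau> Y e \<S> \<S>' \<Longrightarrow>
    agree \<tau> Y d (apply_modification \<tau> P (\<delta>, S, as) \<S>) (apply_modification \<tau> P (\<delta>, S, as) \<S>')"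
    using agree_apply_modification[OF assms, where d = d] by metis
  show ?case
  proof (intro exI[of _ e] allI impI, elim conjE)
    fix Y :: "'d set" and \<S> \<S>' ass
    assume "length ass = Suc l" "set ass \<subseteq> tuples Y m" and agr: "agree \<tau> Y e \<S> \<S>'"
    then obtain as ass' where ass: "ass = as # ass'" "length ass' = l" "as \<in> tuples Y m"
      "set ass' \<subseteq> tuples Y m"
      by (auto simp: length_Suc_conv)
    show "agree \<tau> Y 0 (fold (apply_modification \<tau> P) (map (\<lambda>as. (\<delta>, S, as)) ass) \<S>)
        (fold (apply_modification \<tau> P) (map (\<lambda>as. (\<delta>, S, as)) ass) \<S>')"
      using d[OF ass(2,4) e[OF ass(3) agr]] by (simp add: ass(1) del: apply_modification.simps)
  qed
qed

text \<open>Provides the domain part of \<open>agree\<close> for initial states. Since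
  \<open>is_aux\<close> controls functions only on tuples over \<open>D\<close>, the argument goes
  level by level.\<close>

lemma value_of_init_state_in_domain:
  assumes "is_aux \<tau> D (Init D I)" and "Y \<subseteq> D" and "t \<in> terms_upto (aux_funs \<tau>) Y k"
  shows "value_of (init_state Init D I) t \<in> D"
  using assms(3)
proof (induction k arbitrary: t)
  case 0
  then show ?case using assms(2) by auto
next
  case (Suc k)
  show ?case
  proof (cases "t \<in> terms_upto (aux_funs \<tau>) Y k")
    case False
    then obtain f ts where t: "t = Fn f ts" and f: "aux_funs \<tau> f = Some (length ts)"
      and ts: "set ts \<subseteq> terms_upto (aux_funs \<tau>) Y k"
      using Suc.prems by auto
    have "\<forall>t\<in>set ts. value_of (init_state Init D I) t \<in> D" using ts Suc.IH by blast
    then have "map (value_of (init_state Init D I)) ts \<in> tuples D (length ts)"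
      by (auto simp: tuples_def)
    moreover have "aux_fun (init_state Init D I) f bs \<in> D" if "bs \<in> tuples D (length ts)" for bs
      using assms(1) f that by (cases "Init D I") (auto simp: is_aux_def init_state_def)
    ultimately show ?thesis unfolding t eval_trm.simps by blast
  qed (rule Suc.IH)
qed

section \<open>The query\<close>

definition cover_schema :: "nat \<rightharpoonup> nat" where
  "cover_schema = [0 \<mapsto> 2, 1 \<mapsto> 1]"

definition cover_sentence :: "(nat, nat, nat) fo" where
  "cover_sentence = Ex 0 (All 1 (Disj (Neg (Rel 1 [Var 1])) (Rel 0 [Var 0, Var 1])))"

text \<open>\<open>E\<close> is symbol 0 and \<open>U\<close> is symbol 1. The witness of \<open>A\<close> is the number coding \<open>A\<close>; it may
  coincide with an element of \<open>Y\<close>, which does no harm.\<close>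

definition family_db :: "nat set set \<Rightarrow> nat db" where
  "family_db \<F> = (\<lambda>_. {})(0 := {[set_encode A, y] |A y. A \<in> \<F> \<and> y \<in> A})"

lemma dom_cover_schema: "dom cover_schema = {0, 1}"
  by (auto simp: cover_schema_def)

lemma query_sentence_cover: "query_sentence cover_schema cover_sentence"
  by (auto simp: query_sentence_def cover_schema_def cover_sentence_def)

lemma exists_forall_form_cover: "exists_forall_form cover_sentence"
  unfolding exists_forall_form_def cover_sentence_def
  by (intro exI[of _ "[0]"] exI[of _ "[1]"] exI) auto

lemma defined_query_cover:
  "defined_query cover_sentence D I \<longleftrightarrow> (\<exists>x\<in>D. \<forall>y\<in>D. [y] \<in> I 1 \<longrightarrow> [x, y] \<in> I 0)"
  by (auto simp: defined_query_def cover_sentence_def)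

text \<open>The code is a sum of distinct powers \<open>2 ^ i\<close> with \<open>i < n\<close>, at
  most \<open>2 ^ n - 1\<close>. Hence a domain of \<open>2 ^ n\<close> numbers holds the witnesses
  of all subsets.\<close>

lemma set_encode_less:
  assumes "A \<subseteq> {..<n}"
  shows "set_encode A < 2 ^ n"
proof -
  have "set_encode A \<le> (\<Sum>i<n. 2 ^ i)"
    unfolding set_encode_def using assms by (intro sum_mono2) auto
  also have "\<dots> < 2 ^ n" by (induction n) auto
  finally show ?thesis .
qed

lemma less_two_power_trans: "y < n \<Longrightarrow> y < (2 :: nat) ^ n"
  by (meson less_exp order.strict_trans)

lemma is_db_family:
  assumes "\<And>A. A \<in> \<F> \<Longrightarrow> A \<subseteq> {..<n}"
  shows "is_db cover_schema {..<2 ^ n} (family_db \<F>)"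
proof -
  have "[set_encode A, y] \<in> tuples {..<2 ^ n} 2" if "A \<in> \<F>" "y \<in> A" for A y
    using assms[OF that(1)] that(2) set_encode_less[of A n] less_two_power_trans[of y n]
    by (auto simp: tuples_def)
  then have "{[set_encode A, y] |A y. A \<in> \<F> \<and> y \<in> A} \<subseteq> tuples {..<2 ^ n} 2" by blast
  then show ?thesis by (simp add: is_db_def cover_schema_def family_db_def)
qed

lemma fold_modify_Ins:
  "fold modify (map (\<lambda>as. (Ins, S, as)) ass) I = I(S := I S \<union> set ass)"
  by (induction ass arbitrary: I) auto

text \<open>As \<open>A\<close> is nonempty, a witness \<open>x\<close> must be the code of some
  \<open>B\<close> in the family, and injectivity of the coding then puts all of \<open>A\<close>
  inside this \<open>B\<close>. All sets having size \<open>m\<close>, inclusion becomes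
  equality.\<close>

lemma defined_query_family:
  assumes \<F>: "\<And>B. B \<in> \<F> \<Longrightarrow> B \<subseteq> {..<n} \<and> card B = m" and A: "A \<subseteq> {..<n}" "card A = m" "A \<noteq> {}"
    and ass: "set ass = (\<lambda>a. [a]) ` A"
  shows "defined_query cover_sentence {..<2 ^ n}
    (fold modify (map (\<lambda>as. (Ins, 1, as)) ass) (family_db \<F>)) \<longleftrightarrow> A \<in> \<F>"
    (is "defined_query _ _ ?I \<longleftrightarrow> _")
proof
  have I: "[y] \<in> ?I 1 \<longleftrightarrow> y \<in> A" "[x, y] \<in> ?I 0 \<longleftrightarrow> (\<exists>B\<in>\<F>. x = set_encode B \<and> y \<in> B)" for x y
    unfolding fold_modify_Ins ass by (auto simp: family_db_def)
  {
    assume "defined_query cover_sentence {..<2 ^ n} ?I"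
    then obtain x where x: "\<And>y. y < 2 ^ n \<Longrightarrow> y \<in> A \<Longrightarrow> \<exists>B\<in>\<F>. x = set_encode B \<and> y \<in> B"
      unfolding defined_query_cover I by blast
    have x': "\<exists>B\<in>\<F>. x = set_encode B \<and> y \<in> B" if "y \<in> A" for y
      using x[OF _ that] A(1) that less_two_power_trans by blast
    obtain y where "y \<in> A" using A(3) by blast
    then obtain B where B: "B \<in> \<F>" "x = set_encode B" using x' by blast
    \<comment> \<open>Decoding inverts \<open>set_encode\<close> on finite sets only.\<close>
    have fin: "finite C" if "C \<in> \<F>" for C using \<F>[OF that] finite_subset by blast
    have "A \<subseteq> B"
    proof
      fix z assume "z \<in> A"
      then obtain C where C: "C \<in> \<F>" "x = set_encode C" "z \<in> C" using x' by blast
      have "B = C" using B C(1,2) fin set_encode_inverse by metis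
      then show "z \<in> B" using C(3) by simp
    qed
    then have "A = B" using \<F>[OF B(1)] A(2) fin[OF B(1)] by (metis card_subset_eq)
    then show "A \<in> \<F>" using B by simp
  }
  assume "A \<in> \<F>"
  then show "defined_query cover_sentence {..<2 ^ n} ?I"
    unfolding defined_query_cover I using set_encode_less[OF A(1)]
    by (intro bexI[of _ "set_encode A"]) auto
qed

section \<open>Counting\<close>

text \<open>By \<open>n choose m \<ge> (n / m) ^ m\<close>, the binomial coefficient grows with
  degree \<open>r + 1\<close> in \<open>n\<close>, beating any multiple of
  \<open>n ^ r\<close>.\<close>

lemma exists_binomial_greater:
  "\<exists>n>0. K * n ^ r < n choose (r + 1)"
proof -
  define m where "m = r + 1"
  \<comment> \<open>Chosen so that \<open>n ^ m / m ^ m\<close> is exactly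
    \<open>(K + 1) * n ^ r\<close>; the surplus \<open>n ^ r\<close> yields strictness.\<close>
  define n where "n = m ^ m * (K + 1)"
  have "m \<le> m ^ m" by (rule self_le_power) (simp_all add: m_def)
  also have "\<dots> \<le> n" by (simp add: n_def)
  finally have n: "0 < n" "m \<le> n" by (simp_all add: m_def)
  have "(real n / real m) ^ m \<le> real (n choose m)"
    using binomial_ge_n_over_k_pow_k[OF n(2), where ?'a = real] .
  then have "real n ^ m \<le> real m ^ m * real (n choose m)"
    using m_def by (simp add: power_divide pos_divide_le_eq mult.commute del: power_Suc)
  then have "n ^ m \<le> m ^ m * (n choose m)"
    by (metis of_nat_le_iff of_nat_mult of_nat_power)
  moreover have "n ^ m = m ^ m * ((K + 1) * n ^ r)"
    by (simp add: m_def) (simp add: n_def m_def algebra_simps)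
  ultimately have "(K + 1) * n ^ r \<le> n choose m" by (simp add: m_def)
  moreover have "0 < n ^ r" using n by simp
  ultimately have "K * n ^ r < n choose m" unfolding distrib_right by linarith
  then show ?thesis using n(1) m_def by blast
qed

section \<open>The pigeonhole argument\<close>

text \<open>The order of choices avoids circularity: \<open>r\<close> comes from the schema,
  \<open>m\<close> from \<open>r\<close>, the depth \<open>k\<close> from \<open>m\<close>
  insertions, \<open>K\<close> from \<open>k\<close>, and \<open>n\<close> last. Two families with
  the same true atoms are then told apart by the query but not by the program.\<close>

lemma not_maintains_cover:
  fixes \<tau> :: schema and Init :: "nat init"
  assumes \<tau>: "in_rels \<tau> = cover_schema" "unary_functions \<tau>"
    and prog: "dynprop_dynamic_program \<tau> P Init Q"
    and maint: "maintains \<tau> P Init Q (defined_query cover_sentence)"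
  shows False
proof -
  have wf: "wf_schema \<tau>" "dynprop_program \<tau> P" "is_init \<tau> Init" "aux_rels \<tau> Q = Some 0"
    using prog by (auto simp: dynprop_dynamic_program_def)
  have U: "in_rels \<tau> 1 = Some 1" using \<tau> by (simp add: cover_schema_def)
  let ?rar = "all_rels \<tau>"
  have "dom ?rar \<subseteq> Inl ` dom (in_rels \<tau>) \<union> Inr ` dom (aux_rels \<tau>)"
    by (force split: sum.splits)
  then have fin: "finite (dom ?rar)" "finite (dom (aux_funs \<tau>))"
    using wf(1) by (auto simp: wf_schema_def intro: finite_subset)
  \<comment> \<open>The inserted 2 gives \<open>2 \<le> r\<close>, as the count of equality atoms
    requires.\<close>
  define r where "r = Max (insert 2 (ran ?rar))"
  have r: "\<forall>k\<in>ran ?rar. k \<le> r" "2 \<le> r"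
    using finite_ran[OF fin(1)] by (auto simp: r_def)
  define m where "m = r + 1"
  obtain k where k: "\<And>(Y :: nat set) \<S> \<S>' ass. length ass = m \<Longrightarrow> set ass \<subseteq> tuples Y 1 \<Longrightarrow>
      agree \<tau> Y k \<S> \<S>' \<Longrightarrow>
      agree \<tau> Y 0 (fold (apply_modification \<tau> P) (map (\<lambda>as. (Ins, 1, as)) ass) \<S>)
        (fold (apply_modification \<tau> P) (map (\<lambda>as. (Ins, 1, as)) ass) \<S>')"
    using agree_apply_modifications[OF wf(1,2) U, where l = m and \<delta> = Ins and ?'d = nat] by metis
  obtain K where K: "\<And>Y :: nat set. finite Y \<Longrightarrow> Y \<noteq> {} \<Longrightarrow> finite (atoms_upto (aux_funs \<tau>) ?rar Y k) \<and>
      card (atoms_upto (aux_funs \<tau>) ?rar Y k) \<le> K * card Y ^ r"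
    using card_atoms_upto[OF fin(2) _ fin(1) r, of k] \<tau>(2) unfolding unary_functions_def by metis
  obtain n where n: "0 < n" "K * n ^ r < n choose m"
    using exists_binomial_greater m_def by blast
  define Y where "Y = {..<n}"
  \<comment> \<open>\<open>D\<close> contains \<open>Y\<close> and all possible witnesses. Its
    exponential size is harmless: atoms are counted over \<open>Y\<close>, the only elements that
    the insertions mention.\<close>
  define D where "D = {..<(2 :: nat) ^ n}"
  have Y: "finite Y" "Y \<noteq> {}" "card Y = n" "Y \<subseteq> D"
    using n(1) less_two_power_trans by (auto simp: Y_def D_def)
  have D: "finite D" "D \<noteq> {}" using Y(2,4) by (auto simp: D_def)
  define At where "At = atoms_upto (aux_funs \<tau>) ?rar Y k"
  define subsets where "subsets = {A. A \<subseteq> Y \<and> card A = m}"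
  define init where "init \<F> = init_state Init D (family_db \<F>)" for \<F>
  define true_atoms where "true_atoms \<F> = {a \<in> At. holds (init \<F>) a}" for \<F>
  have At: "finite At" "card At < card subsets"
    using K[OF Y(1,2)] n(2) n_subsets[OF Y(1), of m] Y(3) by (auto simp: At_def subsets_def)
  have "finite subsets" using Y(1) by (auto simp: subsets_def)
  \<comment> \<open>Fewer atoms than \<open>m\<close>-subsets means fewer sets of true atoms than
    families.\<close>
  then have "card (Pow At) < card (Pow subsets)" using At by (simp add: card_Pow)
  moreover have "true_atoms ` Pow subsets \<subseteq> Pow At" by (auto simp: true_atoms_def)
  ultimately have "\<not> inj_on true_atoms (Pow subsets)"
    using At(1) by (metis card_inj_on_le finite_Pow_iff leD)
  then obtain \<F> \<G> where FG: "\<F> \<subseteq> subsets" "\<G> \<subseteq> subsets" "\<F> \<noteq> \<G>" "true_atoms \<F> = true_atoms \<G>"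
    by (auto simp: inj_on_def)
  then obtain A where A: "A \<in> subsets" "A \<in> \<F> \<longleftrightarrow> A \<notin> \<G>" by blast
  have A': "A \<subseteq> {..<n}" "card A = m" "A \<noteq> {}" "finite A"
    using A(1) Y(1) finite_subset by (auto simp: subsets_def Y_def m_def)
  \<comment> \<open>The elements of \<open>A\<close> are inserted one by one in a fixed order, by
    the same sequence for both families.\<close>
  define ass where "ass = map (\<lambda>a. [a]) (sorted_list_of_set A)"
  define \<alpha> where "\<alpha> = map (\<lambda>as. (Ins, 1 :: nat, as)) ass"
  have ass: "length ass = m" "set ass = (\<lambda>a. [a]) ` A" "set ass \<subseteq> tuples Y 1"
    using A' by (auto simp: ass_def tuples_def Y_def)
  define reached where "reached \<H> = fold (apply_modification \<tau> P) \<alpha> (init \<H>)" for \<H>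
  have db: "is_db (in_rels \<tau>) D (family_db \<H>)" if "\<H> \<subseteq> subsets" for \<H>
    unfolding \<tau>(1) D_def using that by (intro is_db_family) (auto simp: subsets_def Y_def)
  have answer: "[] \<in> aux_rel (reached \<H>) Q \<longleftrightarrow> A \<in> \<H>" if "\<H> \<subseteq> subsets" for \<H>
  proof -
    have "\<forall>\<delta>\<in>set \<alpha>. is_modification (in_rels \<tau>) D \<delta>"
      using ass(3) Y(4) U by (auto simp: \<alpha>_def is_modification_def tuples_def)
    then have "[] \<in> aux_rel (reached \<H>) Q \<longleftrightarrow>
        defined_query cover_sentence D (fold modify \<alpha> (family_db \<H>))"
      using maint D db[OF that] unfolding maintains_def reached_def init_def by blast
    also have "\<dots> \<longleftrightarrow> A \<in> \<H>"
      unfolding \<alpha>_def D_def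
      by (rule defined_query_family[where m = m]) (use that A' ass in \<open>auto simp: subsets_def Y_def\<close>)
    finally show ?thesis .
  qed
  have "value_of (init \<H>) t \<in> domain (init \<H>)"
    if "\<H> \<subseteq> subsets" "t \<in> terms_upto (aux_funs \<tau>) Y k" for \<H> t
  proof -
    have "is_aux \<tau> D (Init D (family_db \<H>))"
      using wf(3) D db[OF that(1)] by (simp add: is_init_def)
    from value_of_init_state_in_domain[of \<tau> D Init, OF this Y(4) that(2)] show ?thesis
      by (simp add: init_def init_state_def)
  qed
  moreover have "holds (init \<F>) a \<longleftrightarrow> holds (init \<G>) a" if "a \<in> At" for a
    using FG(4) that by (auto simp: true_atoms_def)
  ultimately have "agree \<tau> Y k (init \<F>) (init \<G>)"
    using FG(1,2) unfolding agree_def At_def by blast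
  from k[OF ass(1,3) this] have "agree \<tau> Y 0 (reached \<F>) (reached \<G>)"
    by (simp only: reached_def \<alpha>_def)
  \<comment> \<open>The query atom has no arguments, so agreement at depth 0 covers it.\<close>
  from agree_Rel[OF this, of "Inr Q" "[]"] have "[] \<in> aux_rel (reached \<F>) Q \<longleftrightarrow> [] \<in> aux_rel (reached \<G>) Q"
    using wf(4) by simp
  then show False using answer FG(1,2) A(2) by blast
qed

text \<open>A program that maintains the query over all finite domains does so over finite sets of
  naturals, so refuting it there is enough.\<close>

theorem theorem6p2:
  "\<exists>(\<sigma> :: nat \<rightharpoonup> nat) (p :: (nat, nat, nat) fo).
     finite (dom \<sigma>) \<and> query_sentence \<sigma> p \<and> exists_forall_form p \<and>
     \<not> (\<exists>(\<tau> :: schema) (P :: update_program) (Init :: nat init) (Q :: nat).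
          in_rels \<tau> = \<sigma> \<and> unary_functions \<tau> \<and> dynprop_dynamic_program \<tau> P Init Q \<and>
          maintains \<tau> P Init Q (defined_query p))"
proof (intro exI conjI)
  show "finite (dom cover_schema)" by (simp add: dom_cover_schema)
  show "query_sentence cover_schema cover_sentence" by (rule query_sentence_cover)
  show "exists_forall_form cover_sentence" by (rule exists_forall_form_cover)
  show "\<not> (\<exists>(\<tau> :: schema) (P :: update_program) (Init :: nat init) (Q :: nat).
      in_rels \<tau> = cover_schema \<and> unary_functions \<tau> \<and> dynprop_dynamic_program \<tau> P Init Q \<and>
      maintains \<tau> P Init Q (defined_query cover_sentence))"
    using not_maintains_cover by blast
qed

end
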